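(* Let $A$ be an associative algebra, $M$ an $A$-bimodule, $H$ a Hochschild $2$-cocycle of $A$ with coefficients in $M$, and let $T_t=\sum_{i\ge0}t^iT_i$ be a formal one-parameter deformation of an $H$-twisted Rota-Baxter operator $T:M\to A$. Then the linear term $T_1$ is a $1$-cocycle in the cohomology of $T$, whose cohomology class in $\mathcal H^1_T(M,A)$ depends only on the equivalence class of the deformation $T_t$.
   Context: All vector spaces, linear maps and tensor products are over a field $\mathbb K$ of characteristic $0$. An $A$-bimodule is a vector space $M$ with bilinear left and right actions $a\cdot u$, $u\cdot a$ satisfying $(ab)\cdot u=a\cdot(b\cdot u)$, $(a\cdot u)\cdot b=a\cdot(u\cdot b)$, $(u\cdot a)\cdot b=u\cdot(ab)$. A Hochschild $2$-cocycle is a bilinear map $H:A^{\otimes 2}\to M$ with $a\cdot H(b,c)-H(ab,c)+H(a,bc)-H(a,b)\cdot c=0$. A linear map $T:M\to A$ is an $H$-twisted Rota-Baxter operator if $T(u)T(v)=T(u\cdot T(v)+T(u)\cdot v+H(Tu,Tv))$ for all $u,v\in M$. Cohomology of $T$ in degree 1: for $a\in A$ and $f\in\mathrm{Hom}(M,A)$, the differential $d_T$ of the cohomology complex of $T$ is $$d_T(a)(u)=T(u)a-aT(u)-T(u\cdot a)+T(a\cdot u)-T(H(Tu,a))+T(H(a,Tu)),$$ $$d_T(f)(u,v)=T(f(u)\cdot v+u\cdot f(v))+f(T(u)\cdot v+u\cdot T(v))-T(u)f(v)-f(u)T(v)+T\big(H(Tu,f(v))+H(f(u),Tv)\big)+f(H(Tu,Tv)).$$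 $\mathcal Z^1_T(M,A)=\{f\in\mathrm{Hom}(M,A):d_Tf=0\}$ is the space of $1$-cocycles, $\mathcal B^1_T(M,A)=\{d_T(a):a\in A\}$, and $\mathcal H^1_T(M,A)=\mathcal Z^1_T/\mathcal B^1_T$. The product of $A$, the actions on $M$ and $H$ extend ($\mathbb K[[t]]$-bilinearly) to $A[[t]]$, $M[[t]]$. A formal one-parameter deformation of $T$ is a formal sum $T_t=\sum_{i\ge0}t^iT_i\in\mathrm{Hom}(M,A)[[t]]$ with $T_0=T$ such that $T_t:M[[t]]\to A[[t]]$ is an $H$-twisted Rota-Baxter operator. A morphism of $H$-twisted Rota-Baxter operators from $S$ to $S'$ (both from the bimodule to the algebra) is a pair $(\phi,\psi)$ of an algebra morphism $\phi$ of the algebra and a linear map $\psi$ of the bimodule with $\psi(a\cdot u)=\phi(a)\cdot\psi(u)$, $\psi(u\cdot a)=\psi(u)\cdot\phi(a)$, $\psi\circ H=H\circ(\phi\otimes\phi)$, $\phi\circ S=S'\circ\psi$ (here everything is over $\mathbb K[[t]]$, for $A[[t]]$ and $M[[t]]$). Two formal deformations $T_t=\sum t^iT_i$, $T'_t=\sum t^iT'_i$ of $T$ are equivalent if there exist $a\in A$ and linear maps $\phi_i\in\mathrm{Hom}(A,A)$, $\psi_i\in\mathrm{Hom}(M,M)$, $i\ge2$, such that $$\phi_t=\mathrm{id}_A+t(\mathrm{ad}^l_a-\mathrm{ad}^r_a)+\sum_{i\ge2}t^i\phi_i,\qquad \psi_t=\mathrm{id}_M+t\big(l_a-r_a+H(a,T-)-H(T-,a)\big)+\sum_{i\ge2}t^i\psi_i$$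 is a morphism of $H$-twisted Rota-Baxter operators from $T_t$ to $T'_t$, where $\mathrm{ad}^l_a(b)=ab$, $\mathrm{ad}^r_a(b)=ba$, $l_a(u)=a\cdot u$, $r_a(u)=u\cdot a$. *)

theory Defs
  imports Complex_Main "HOL-Computational_Algebra.Formal_Power_Series"
begin

unbundle fps_syntax

text \<open>
  Everything up to morphisms is stated over a commutative ring, so that one set of definitions
  serves both for vector spaces over a field and for the \<open>K[[t]]\<close>-modules \<open>A[[t]]\<close>, \<open>M[[t]]\<close>.
  Over a field, \<^locale>\<open>module\<close> is the same as \<^locale>\<open>vector_space\<close>, and
  \<^locale>\<open>module_hom\<close> is linearity. Algebras need not have a unit.
\<close>

definition bilinear_map ::
  "('r::comm_ring_1 \<Rightarrow> 'x::ab_group_add \<Rightarrow> 'x) \<Rightarrow> ('r \<Rightarrow> 'y::ab_group_add \<Rightarrow> 'y) \<Rightarrow>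
   ('r \<Rightarrow> 'z::ab_group_add \<Rightarrow> 'z) \<Rightarrow> ('x \<Rightarrow> 'y \<Rightarrow> 'z) \<Rightarrow> bool"
  where "bilinear_map sX sY sZ B \<longleftrightarrow>
    (\<forall>x. module_hom sY sZ (B x)) \<and> (\<forall>y. module_hom sX sZ (\<lambda>x. B x y))"

locale assoc_algebra =
  fixes sA :: "'r::comm_ring_1 \<Rightarrow> 'a::ring \<Rightarrow> 'a"
  assumes bilinear_times: "bilinear_map sA sA sA (*)"

locale bimodule = assoc_algebra sA
  for sA :: "'r::comm_ring_1 \<Rightarrow> 'a::ring \<Rightarrow> 'a" +
  fixes sM :: "'r \<Rightarrow> 'm::ab_group_add \<Rightarrow> 'm"
    and la :: "'a \<Rightarrow> 'm \<Rightarrow> 'm"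
    and ra :: "'m \<Rightarrow> 'a \<Rightarrow> 'm"
  assumes bilinear_la: "bilinear_map sA sM sM la"
    and bilinear_ra: "bilinear_map sM sA sM ra"
    and la_la: "la (a * b) u = la a (la b u)"
    and la_ra: "ra (la a u) b = la a (ra u b)"
    and ra_ra: "ra (ra u a) b = ra u (a * b)"

locale hochschild_2cocycle = bimodule sA sM la ra
  for sA :: "'r::comm_ring_1 \<Rightarrow> 'a::ring \<Rightarrow> 'a"
    and sM :: "'r \<Rightarrow> 'm::ab_group_add \<Rightarrow> 'm"
    and la :: "'a \<Rightarrow> 'm \<Rightarrow> 'm"
    and ra :: "'m \<Rightarrow> 'a \<Rightarrow> 'm" +
  fixes H :: "'a \<Rightarrow> 'a \<Rightarrow> 'm"
  assumes bilinear_H: "bilinear_map sA sA sM H"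
    and cocycle: "la a (H b c) - H (a * b) c + H a (b * c) - ra (H a b) c = 0"

definition twisted_rota_baxter ::
  "('r::comm_ring_1 \<Rightarrow> 'a::ring \<Rightarrow> 'a) \<Rightarrow> ('r \<Rightarrow> 'm::ab_group_add \<Rightarrow> 'm) \<Rightarrow>
   ('a \<Rightarrow> 'm \<Rightarrow> 'm) \<Rightarrow> ('m \<Rightarrow> 'a \<Rightarrow> 'm) \<Rightarrow> ('a \<Rightarrow> 'a \<Rightarrow> 'm) \<Rightarrow> ('m \<Rightarrow> 'a) \<Rightarrow> bool"
  where "twisted_rota_baxter sA sM la ra H T \<longleftrightarrow>
    module_hom sM sA T \<and>
    (\<forall>u v. T u * T v = T (ra u (T v) + la (T u) v + H (T u) (T v)))"

definition trb_morphism ::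
  "('r::comm_ring_1 \<Rightarrow> 'a::ring \<Rightarrow> 'a) \<Rightarrow> ('r \<Rightarrow> 'm::ab_group_add \<Rightarrow> 'm) \<Rightarrow>
   ('a \<Rightarrow> 'm \<Rightarrow> 'm) \<Rightarrow> ('m \<Rightarrow> 'a \<Rightarrow> 'm) \<Rightarrow> ('a \<Rightarrow> 'a \<Rightarrow> 'm) \<Rightarrow>
   ('m \<Rightarrow> 'a) \<Rightarrow> ('m \<Rightarrow> 'a) \<Rightarrow> ('a \<Rightarrow> 'a) \<Rightarrow> ('m \<Rightarrow> 'm) \<Rightarrow> bool"
  where "trb_morphism sA sM la ra H S S' \<phi> \<psi> \<longleftrightarrow>
    module_hom sA sA \<phi> \<and> (\<forall>a b. \<phi> (a * b) = \<phi> a * \<phi> b) \<and>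
    module_hom sM sM \<psi> \<and>
    (\<forall>a u. \<psi> (la a u) = la (\<phi> a) (\<psi> u)) \<and>
    (\<forall>u a. \<psi> (ra u a) = ra (\<psi> u) (\<phi> a)) \<and>
    (\<forall>a b. \<psi> (H a b) = H (\<phi> a) (\<phi> b)) \<and>
    (\<forall>u. \<phi> (S u) = S' (\<psi> u))"


definition d_T0 ::
  "('a::ring \<Rightarrow> 'm::ab_group_add \<Rightarrow> 'm) \<Rightarrow> ('m \<Rightarrow> 'a \<Rightarrow> 'm) \<Rightarrow> ('a \<Rightarrow> 'a \<Rightarrow> 'm) \<Rightarrow> ('m \<Rightarrow> 'a) \<Rightarrow>
   'a \<Rightarrow> 'm \<Rightarrow> 'a"
  where "d_T0 la ra H T a u =
    T u * a - a * T u - T (ra u a) + T (la a u) - T (H (T u) a) + T (H a (T u))"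

definition d_T1 ::
  "('a::ring \<Rightarrow> 'm::ab_group_add \<Rightarrow> 'm) \<Rightarrow> ('m \<Rightarrow> 'a \<Rightarrow> 'm) \<Rightarrow> ('a \<Rightarrow> 'a \<Rightarrow> 'm) \<Rightarrow> ('m \<Rightarrow> 'a) \<Rightarrow>
   ('m \<Rightarrow> 'a) \<Rightarrow> 'm \<Rightarrow> 'm \<Rightarrow> 'a"
  where "d_T1 la ra H T f u v =
    T (la (f u) v + ra u (f v)) + f (la (T u) v + ra u (T v))
    - T u * f v - f u * T v
    + T (H (T u) (f v) + H (f u) (T v)) + f (H (T u) (T v))"

definition Z1_T ::
  "('r::comm_ring_1 \<Rightarrow> 'a::ring \<Rightarrow> 'a) \<Rightarrow> ('r \<Rightarrow> 'm::ab_group_add \<Rightarrow> 'm) \<Rightarrow>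
   ('a \<Rightarrow> 'm \<Rightarrow> 'm) \<Rightarrow> ('m \<Rightarrow> 'a \<Rightarrow> 'm) \<Rightarrow> ('a \<Rightarrow> 'a \<Rightarrow> 'm) \<Rightarrow> ('m \<Rightarrow> 'a) \<Rightarrow> ('m \<Rightarrow> 'a) set"
  where "Z1_T sA sM la ra H T = {f. module_hom sM sA f \<and> (\<forall>u v. d_T1 la ra H T f u v = 0)}"

definition B1_T ::
  "('a::ring \<Rightarrow> 'm::ab_group_add \<Rightarrow> 'm) \<Rightarrow> ('m \<Rightarrow> 'a \<Rightarrow> 'm) \<Rightarrow> ('a \<Rightarrow> 'a \<Rightarrow> 'm) \<Rightarrow> ('m \<Rightarrow> 'a) \<Rightarrow>
   ('m \<Rightarrow> 'a) set"
  where "B1_T la ra H T = range (d_T0 la ra H T)"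

definition cohomologous_T ::
  "('r::comm_ring_1 \<Rightarrow> 'a::ring \<Rightarrow> 'a) \<Rightarrow> ('r \<Rightarrow> 'm::ab_group_add \<Rightarrow> 'm) \<Rightarrow>
   ('a \<Rightarrow> 'm \<Rightarrow> 'm) \<Rightarrow> ('m \<Rightarrow> 'a \<Rightarrow> 'm) \<Rightarrow> ('a \<Rightarrow> 'a \<Rightarrow> 'm) \<Rightarrow> ('m \<Rightarrow> 'a) \<Rightarrow>
   (('m \<Rightarrow> 'a) \<times> ('m \<Rightarrow> 'a)) set"
  where "cohomologous_T sA sM la ra H T =
    {(f, g). f \<in> Z1_T sA sM la ra H T \<and> g \<in> Z1_T sA sM la ra H T \<and>
             (\<lambda>u. f u - g u) \<in> B1_T la ra H T}"

definition H1_T ::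
  "('r::comm_ring_1 \<Rightarrow> 'a::ring \<Rightarrow> 'a) \<Rightarrow> ('r \<Rightarrow> 'm::ab_group_add \<Rightarrow> 'm) \<Rightarrow>
   ('a \<Rightarrow> 'm \<Rightarrow> 'm) \<Rightarrow> ('m \<Rightarrow> 'a \<Rightarrow> 'm) \<Rightarrow> ('a \<Rightarrow> 'a \<Rightarrow> 'm) \<Rightarrow> ('m \<Rightarrow> 'a) \<Rightarrow> ('m \<Rightarrow> 'a) set set"
  where "H1_T sA sM la ra H T = Z1_T sA sM la ra H T // cohomologous_T sA sM la ra H T"

text \<open>Only meaningful for \<open>f\<close> in \<^const>\<open>Z1_T\<close>; it is the empty set otherwise.\<close>

definition class_T ::
  "('r::comm_ring_1 \<Rightarrow> 'a::ring \<Rightarrow> 'a) \<Rightarrow> ('r \<Rightarrow> 'm::ab_group_add \<Rightarrow> 'm) \<Rightarrow>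
   ('a \<Rightarrow> 'm \<Rightarrow> 'm) \<Rightarrow> ('m \<Rightarrow> 'a \<Rightarrow> 'm) \<Rightarrow> ('a \<Rightarrow> 'a \<Rightarrow> 'm) \<Rightarrow> ('m \<Rightarrow> 'a) \<Rightarrow>
   ('m \<Rightarrow> 'a) \<Rightarrow> ('m \<Rightarrow> 'a) set"
  where "class_T sA sM la ra H T f = cohomologous_T sA sM la ra H T `` {f}"


text \<open>
  The \<open>K[[t]]\<close>-bilinear extension of a bilinear map to formal power series; the scalar action of
  \<open>K[[t]]\<close> on \<open>A[[t]]\<close> and \<open>M[[t]]\<close> is the extension of the action of \<open>K\<close>. For the product of \<open>A\<close>
  it is the library product of \<^typ>\<open>'a::ring fps\<close>, see \<open>fps_bilinear_times\<close>.
\<close>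

definition fps_bilinear :: "('x \<Rightarrow> 'y \<Rightarrow> 'z::comm_monoid_add) \<Rightarrow> 'x fps \<Rightarrow> 'y fps \<Rightarrow> 'z fps"
  where "fps_bilinear B f g = Abs_fps (\<lambda>n. \<Sum>i=0..n. B (f $ i) (g $ (n - i)))"

text \<open>
  An element of \<open>Hom(X,Y)[[t]]\<close> is a series \<^typ>\<open>('x \<Rightarrow> 'y) fps\<close> with linear coefficients, and it
  acts as a map \<open>X[[t]] \<rightarrow> Y[[t]]\<close> by extending evaluation.
\<close>

definition fps_app :: "('x \<Rightarrow> 'y::comm_monoid_add) fps \<Rightarrow> 'x fps \<Rightarrow> 'y fps"
  where "fps_app = fps_bilinear (\<lambda>f x. f x)"

definition formal_deformation ::
  "('k::field \<Rightarrow> 'a::ring \<Rightarrow> 'a) \<Rightarrow> ('k \<Rightarrow> 'm::ab_group_add \<Rightarrow> 'm) \<Rightarrow>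
   ('a \<Rightarrow> 'm \<Rightarrow> 'm) \<Rightarrow> ('m \<Rightarrow> 'a \<Rightarrow> 'm) \<Rightarrow> ('a \<Rightarrow> 'a \<Rightarrow> 'm) \<Rightarrow> ('m \<Rightarrow> 'a) \<Rightarrow>
   ('m \<Rightarrow> 'a) fps \<Rightarrow> bool"
  where "formal_deformation sA sM la ra H T Tt \<longleftrightarrow>
    (\<forall>i. module_hom sM sA (Tt $ i)) \<and> Tt $ 0 = T \<and>
    twisted_rota_baxter (fps_bilinear sA) (fps_bilinear sM)
      (fps_bilinear la) (fps_bilinear ra) (fps_bilinear H) (fps_app Tt)"

definition equivalent_deformations ::
  "('k::field \<Rightarrow> 'a::ring \<Rightarrow> 'a) \<Rightarrow> ('k \<Rightarrow> 'm::ab_group_add \<Rightarrow> 'm) \<Rightarrow>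
   ('a \<Rightarrow> 'm \<Rightarrow> 'm) \<Rightarrow> ('m \<Rightarrow> 'a \<Rightarrow> 'm) \<Rightarrow> ('a \<Rightarrow> 'a \<Rightarrow> 'm) \<Rightarrow> ('m \<Rightarrow> 'a) \<Rightarrow>
   ('m \<Rightarrow> 'a) fps \<Rightarrow> ('m \<Rightarrow> 'a) fps \<Rightarrow> bool"
  where "equivalent_deformations sA sM la ra H T Tt Tt' \<longleftrightarrow>
    (\<exists>a \<phi> \<psi>.
      \<phi> $ 0 = id \<and> \<phi> $ 1 = (\<lambda>b. a * b - b * a) \<and> (\<forall>i\<ge>2. module_hom sA sA (\<phi> $ i)) \<and>
      \<psi> $ 0 = id \<and> \<psi> $ 1 = (\<lambda>u. la a u - ra u a + H a (T u) - H (T u) a) \<and>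
      (\<forall>i\<ge>2. module_hom sM sM (\<psi> $ i)) \<and>
      trb_morphism (fps_bilinear sA) (fps_bilinear sM)
        (fps_bilinear la) (fps_bilinear ra) (fps_bilinear H)
        (fps_app Tt) (fps_app Tt') (fps_app \<phi>) (fps_app \<psi>))"


text \<open>
  The extended data over \<open>K[[t]]\<close> again consist of an algebra, a bimodule and a 2-cocycle, so the
  general definitions above do apply to them.
\<close>

lemma fps_bilinear_nth: "fps_bilinear B f g $ n = (\<Sum>i=0..n. B (f $ i) (g $ (n - i)))"
  by (simp add: fps_bilinear_def)

lemma fps_bilinear_times: "fps_bilinear (*) f g = f * g"
  by (simp add: fps_eq_iff fps_bilinear_nth fps_mult_nth)

lemma fps_bilinear_swap: "fps_bilinear B f g = fps_bilinear (\<lambda>y x. B x y) g f"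
  by (simp add: fps_eq_iff fps_bilinear_nth fps_mult_commute_lemma[where f = "\<lambda>i j. B (f $ i) (g $ j)" for f g])

lemma fps_bilinear_nth_right:
  assumes "\<And>x. additive (B x)"
  shows "fps_bilinear B f (fps_bilinear C g h) $ n =
    (\<Sum>j=0..n. \<Sum>i=0..n - j. B (f $ j) (C (g $ i) (h $ (n - j - i))))"
  by (simp add: fps_bilinear_nth additive.sum[OF assms])

lemma fps_bilinear_nth_left:
  assumes "\<And>y. additive (\<lambda>x. B x y)"
  shows "fps_bilinear B (fps_bilinear C f g) h $ n =
    (\<Sum>j=0..n. \<Sum>i=0..n - j. B (C (f $ j) (g $ i)) (h $ (n - j - i)))"
proof -
  have "fps_bilinear B (fps_bilinear C f g) h $ n =
      (\<Sum>j=0..n. \<Sum>i=0..j. B (C (f $ i) (g $ (j - i))) (h $ (n - j)))"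
    by (simp add: fps_bilinear_nth additive.sum[OF assms])
  also have "\<dots> = (\<Sum>j=0..n. \<Sum>i=0..n - j. B (C (f $ j) (g $ i)) (h $ (n - j - i)))"
    by (rule fps_mult_assoc_lemma[where f = "\<lambda>i j k. B (C (f $ i) (g $ j)) (h $ k)"])
  finally show ?thesis .
qed

lemma bilinear_map_additive:
  assumes "bilinear_map sX sY sZ B"
  shows "additive (B x)" "additive (\<lambda>x. B x y)"
  using assms unfolding bilinear_map_def additive_def module_hom_def module_hom_axioms_def by blast+

lemma module_additive:
  assumes "module s"
  shows "additive (s c)" "additive (\<lambda>c. s c x)"
  using assms by (simp_all add: additive_def module.scale_right_distrib module.scale_left_distrib)

lemma fps_bilinear_assoc:
  assumes "\<And>x. additive (B x)" "\<And>y. additive (\<lambda>x. B' x y)"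
    and "\<And>x y z. B x (C y z) = B' (C' x y) z"
  shows "fps_bilinear B f (fps_bilinear C g h) = fps_bilinear B' (fps_bilinear C' f g) h"
  by (simp add: fps_eq_iff fps_bilinear_nth_right fps_bilinear_nth_left assms)

lemma fps_bilinear_add_right:
  assumes "\<And>x. additive (B x)"
  shows "fps_bilinear B f (g + h) = fps_bilinear B f g + fps_bilinear B f h"
  by (simp add: fps_eq_iff fps_bilinear_nth additive.add[OF assms] sum.distrib)

lemma fps_bilinear_add_left:
  assumes "\<And>y. additive (\<lambda>x. B x y)"
  shows "fps_bilinear B (f + g) h = fps_bilinear B f h + fps_bilinear B g h"
  by (simp add: fps_eq_iff fps_bilinear_nth additive.add[OF assms] sum.distrib)

lemma module_fps:
  assumes "module s"
  shows "module (fps_bilinear s)"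
proof
  fix a b :: "'a fps" and x y :: "'b fps"
  interpret module s by fact
  note add = module_additive[OF assms]
  show "fps_bilinear s a (x + y) = fps_bilinear s a x + fps_bilinear s a y"
    by (rule fps_bilinear_add_right) (rule add)
  show "fps_bilinear s (a + b) x = fps_bilinear s a x + fps_bilinear s b x"
    by (rule fps_bilinear_add_left) (rule add)
  show "fps_bilinear s a (fps_bilinear s b x) = fps_bilinear s (a * b) x"
    unfolding fps_bilinear_times[symmetric]
    by (rule fps_bilinear_assoc) (simp_all add: add)
  show "fps_bilinear s 1 x = x"
  proof (rule fps_ext)
    fix n
    have "fps_bilinear s 1 x $ n = (\<Sum>i=0..n. if i = 0 then x $ n else 0)"
      unfolding fps_bilinear_nth by (rule sum.cong) auto
    then show "fps_bilinear s 1 x $ n = x $ n" by simp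
  qed
qed

lemma module_hom_fps_right:
  assumes "bilinear_map sX sY sZ B"
  shows "module_hom (fps_bilinear sY) (fps_bilinear sZ) (fps_bilinear B x)"
proof -
  have mods: "module sX" "module sY" "module sZ"
    using assms unfolding bilinear_map_def module_hom_def by blast+
  have scale: "B u (sY c v) = sZ c (B u v)" for u c v
    using assms unfolding bilinear_map_def by (simp add: module_hom.scale)
  note add = bilinear_map_additive[OF assms]
  show ?thesis
  proof (intro module_hom.intro module_hom_axioms.intro module_fps mods)
    show "fps_bilinear B x (y + z) = fps_bilinear B x y + fps_bilinear B x z" for y z
      by (rule fps_bilinear_add_right) (rule add)
    show "fps_bilinear B x (fps_bilinear sY c y) = fps_bilinear sZ c (fps_bilinear B x y)" for c y
      unfolding fps_bilinear_swap[of B]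
      by (rule fps_bilinear_assoc[symmetric]) (simp_all add: module_additive mods add scale)
  qed
qed

lemma bilinear_map_fps:
  assumes "bilinear_map sX sY sZ B"
  shows "bilinear_map (fps_bilinear sX) (fps_bilinear sY) (fps_bilinear sZ) (fps_bilinear B)"
proof -
  have "bilinear_map sY sX sZ (\<lambda>y x. B x y)"
    using assms by (simp add: bilinear_map_def)
  note swapped = module_hom_fps_right[OF this]
  show ?thesis
    unfolding bilinear_map_def
  proof (intro conjI allI)
    fix x y
    show "module_hom (fps_bilinear sY) (fps_bilinear sZ) (fps_bilinear B x)"
      by (rule module_hom_fps_right[OF assms])
    show "module_hom (fps_bilinear sX) (fps_bilinear sZ) (\<lambda>x. fps_bilinear B x y)"
      using swapped[of y] by (simp add: fps_bilinear_swap[of B])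
  qed
qed

lemma hochschild_2cocycle_fps:
  assumes "hochschild_2cocycle sA sM la ra H"
  shows "hochschild_2cocycle (fps_bilinear sA) (fps_bilinear sM)
    (fps_bilinear la) (fps_bilinear ra) (fps_bilinear H)"
proof -
  interpret hochschild_2cocycle sA sM la ra H by fact
  note add = bilinear_map_additive[OF bilinear_times] bilinear_map_additive[OF bilinear_la]
    bilinear_map_additive[OF bilinear_ra] bilinear_map_additive[OF bilinear_H]
  have times: "(*) = fps_bilinear ((*) :: 'b \<Rightarrow> 'b \<Rightarrow> 'b)"
    by (intro ext) (simp add: fps_bilinear_times)
  show ?thesis
  proof
    show "bilinear_map (fps_bilinear sA) (fps_bilinear sA) (fps_bilinear sA) (*)"
      unfolding times by (rule bilinear_map_fps[OF bilinear_times])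
    show "bilinear_map (fps_bilinear sA) (fps_bilinear sM) (fps_bilinear sM) (fps_bilinear la)"
      "bilinear_map (fps_bilinear sM) (fps_bilinear sA) (fps_bilinear sM) (fps_bilinear ra)"
      "bilinear_map (fps_bilinear sA) (fps_bilinear sA) (fps_bilinear sM) (fps_bilinear H)"
      by (intro bilinear_map_fps bilinear_la bilinear_ra bilinear_H)+
    fix a b c :: "'b fps" and u :: "'c fps"
    show "fps_bilinear la (a * b) u = fps_bilinear la a (fps_bilinear la b u)"
      unfolding times by (rule fps_bilinear_assoc[symmetric]) (simp_all add: add la_la)
    show "fps_bilinear ra (fps_bilinear la a u) b = fps_bilinear la a (fps_bilinear ra u b)"
      by (rule fps_bilinear_assoc[symmetric]) (simp_all add: add la_ra)
    show "fps_bilinear ra (fps_bilinear ra u a) b = fps_bilinear ra u (a * b)"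
      unfolding times by (rule fps_bilinear_assoc[symmetric]) (simp_all add: add ra_ra)
    show "fps_bilinear la a (fps_bilinear H b c) - fps_bilinear H (a * b) c
        + fps_bilinear H a (b * c) - fps_bilinear ra (fps_bilinear H a b) c = 0"
      unfolding times
      by (simp add: fps_eq_iff fps_bilinear_nth_right fps_bilinear_nth_left add cocycle
          flip: sum.distrib sum_subtractf)
  qed
qed

lemma module_hom_fps_app:
  assumes "module sX" "module sY" "\<And>i. module_hom sX sY (F $ i)"
  shows "module_hom (fps_bilinear sX) (fps_bilinear sY) (fps_app F)"
proof (intro module_hom.intro module_hom_axioms.intro module_fps assms(1,2))
  fix c x y
  show "fps_app F (x + y) = fps_app F x + fps_app F y"
    by (simp add: fps_eq_iff fps_app_def fps_bilinear_nth module_hom.add[OF assms(3)] sum.distrib)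
  have "fps_app F (fps_bilinear sX c x) $ n = fps_bilinear sY c (fps_app F x) $ n" for n
  proof -
    have "fps_app F (fps_bilinear sX c x) $ n =
        fps_bilinear (\<lambda>x f. f x) (fps_bilinear sX c x) F $ n"
      unfolding fps_app_def by (subst fps_bilinear_swap) simp
    also have "\<dots> = (\<Sum>j=0..n. \<Sum>i=0..j. (F $ (n - j)) (sX (c $ i) (x $ (j - i))))"
      by (simp add: fps_bilinear_nth module_hom.sum[OF assms(3)])
    also have "\<dots> = (\<Sum>j=0..n. \<Sum>i=0..n - j. (F $ (n - j - i)) (sX (c $ j) (x $ i)))"
      by (rule fps_mult_assoc_lemma[where f = "\<lambda>i j k. (F $ k) (sX (c $ i) (x $ j))"])
    also have "\<dots> = fps_bilinear sY c (fps_bilinear (\<lambda>x f. f x) x F) $ n"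
      by (simp add: fps_bilinear_nth module_hom.scale[OF assms(3)] module.scale_sum_right[OF assms(2)])
    also have "fps_bilinear (\<lambda>x f. f x) x F = fps_app F x"
      unfolding fps_app_def by (subst fps_bilinear_swap) simp
    finally show ?thesis .
  qed
  then show "fps_app F (fps_bilinear sX c x) = fps_bilinear sY c (fps_app F x)"
    by (simp add: fps_eq_iff)
qed

end

theory Submission
  imports Defs
begin

text \<open>
  Only the coefficients of \<open>t\<close> matter. In the Rota-Baxter identity for \<open>T_t\<close> on constant series it
  says exactly \<open>d_T(T_1) = 0\<close>. In \<open>\<phi>_t \<circ> T_t = T'_t \<circ> \<psi>_t\<close> on constant series it says
  \<open>T_1 - T'_1 = d_T(a)\<close> for the element \<open>a\<close> that determines the linear terms of \<open>\<phi>_t\<close> and \<open>\<psi>_t\<close>.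
\<close>

lemma fps_bilinear_nth_0: "fps_bilinear B f g $ 0 = B (f $ 0) (g $ 0)"
  by (simp add: fps_bilinear_nth)

text \<open>The index is written \<open>Suc 0\<close> because the simplifier normalises the natural
  number \<open>1\<close> to it; otherwise the rule would not fire.\<close>

lemma fps_bilinear_nth_1: "fps_bilinear B f g $ Suc 0 = B (f $ 0) (g $ 1) + B (f $ 1) (g $ 0)"
  by (simp add: fps_bilinear_nth)

lemma fps_app_nth_0: "fps_app F x $ 0 = (F $ 0) (x $ 0)"
  by (simp add: fps_app_def fps_bilinear_nth_0)

lemma fps_app_nth_1: "fps_app F x $ Suc 0 = (F $ 0) (x $ 1) + (F $ 1) (x $ 0)"
  by (simp add: fps_app_def fps_bilinear_nth_1)

context hochschild_2cocycle
begin

text \<open>For each of \<open>la\<close>, \<open>ra\<close>, \<open>H\<close> in turn: first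
  additivity in the second argument, then in the first. Later proofs select by this
  numbering.\<close>

lemmas additive_maps =
  bilinear_map_additive[OF bilinear_la] bilinear_map_additive[OF bilinear_ra]
  bilinear_map_additive[OF bilinear_H]

text \<open>Makes the coboundaries closed under zero, negation and sums.\<close>

lemma additive_d_T0:
  assumes "module_hom sM sA T"
  shows "additive (\<lambda>a. d_T0 la ra H T a u)"
  by (simp add: additive_def d_T0_def additive.add[OF additive_maps(1)]
      additive.add[OF additive_maps(2)] additive.add[OF additive_maps(3)]
      additive.add[OF additive_maps(5)] additive.add[OF additive_maps(6)]
      module_hom.add[OF assms] algebra_simps)

text \<open>Reflexivity, symmetry and transitivity are witnessed by the coboundaries of
  \<open>0\<close>, \<open>- a\<close> and \<open>a + b\<close>. This turns cohomologous cocycles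
  into equal classes.\<close>

lemma equiv_cohomologous_T:
  assumes "module_hom sM sA T"
  shows "equiv (Z1_T sA sM la ra H T) (cohomologous_T sA sM la ra H T)"
proof (rule equivI)
  note d = additive_d_T0[OF assms]
  let ?d = "d_T0 la ra H T"
  show "cohomologous_T sA sM la ra H T \<subseteq> Z1_T sA sM la ra H T \<times> Z1_T sA sM la ra H T"
    by (auto simp: cohomologous_T_def)
  have "(\<lambda>u. f u - f u) \<in> B1_T la ra H T" for f
    unfolding B1_T_def by (rule range_eqI[of _ _ 0]) (simp add: fun_eq_iff additive.zero[OF d])
  then show "refl_on (Z1_T sA sM la ra H T) (cohomologous_T sA sM la ra H T)"
    by (simp add: refl_on_def cohomologous_T_def)
  show "sym (cohomologous_T sA sM la ra H T)"
  proof (rule symI)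
    fix f g assume fg: "(f, g) \<in> cohomologous_T sA sM la ra H T"
    then obtain a where a: "(\<lambda>u. f u - g u) = ?d a"
      by (auto simp: cohomologous_T_def B1_T_def)
    have "(\<lambda>u. g u - f u) = ?d (- a)"
      by (simp add: fun_eq_iff additive.minus[OF d] flip: a)
    with fg show "(g, f) \<in> cohomologous_T sA sM la ra H T"
      by (simp add: cohomologous_T_def B1_T_def)
  qed
  show "trans (cohomologous_T sA sM la ra H T)"
  proof (rule transI)
    fix f g h
    assume fg: "(f, g) \<in> cohomologous_T sA sM la ra H T"
      and gh: "(g, h) \<in> cohomologous_T sA sM la ra H T"
    then obtain a b where a: "(\<lambda>u. f u - g u) = ?d a" and b: "(\<lambda>u. g u - h u) = ?d b"
      by (auto simp: cohomologous_T_def B1_T_def)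
    have "(\<lambda>u. f u - h u) = ?d (a + b)"
      by (simp add: fun_eq_iff additive.add[OF d] flip: a b)
    with fg gh show "(f, h) \<in> cohomologous_T sA sM la ra H T"
      by (simp add: cohomologous_T_def B1_T_def)
  qed
qed

end

lemma linear_term_cocycle:
  assumes "hochschild_2cocycle sA sM la ra H"
    and "formal_deformation sA sM la ra H T Tt"
  shows "Tt $ 1 \<in> Z1_T sA sM la ra H T"
proof -
  interpret hochschild_2cocycle sA sM la ra H by fact
  have hom: "module_hom sM sA (Tt $ i)" for i
    using assms by (simp add: formal_deformation_def)
  have T: "Tt $ 0 = T"
    using assms by (simp add: formal_deformation_def)
  note app = fps_app_nth_0 fps_app_nth_1
  \<comment> \<open>Constant series have zero coefficient of t, so terms such as \<open>T 0\<close>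
    arise and must vanish.\<close>
  note T_0 = module_hom.zero[OF hom[of 0], unfolded T]
  have "d_T1 la ra H T (Tt $ 1) u v = 0" for u v
  proof -
    let ?U = "fps_app Tt (fps_const u)" and ?V = "fps_app Tt (fps_const v)"
    let ?w = "fps_bilinear ra (fps_const u) ?V + fps_bilinear la ?U (fps_const v)
      + fps_bilinear H ?U ?V"
    have "(?U * ?V) $ 1 = fps_app Tt ?w $ 1"
      using assms by (simp add: formal_deformation_def twisted_rota_baxter_def)
    moreover have "(?U * ?V) $ 1 = T u * (Tt $ 1) v + (Tt $ 1) u * T v"
      by (simp add: fps_bilinear_nth_1 app T T_0 flip: fps_bilinear_times)
    moreover have "fps_app Tt ?w $ 1 =
        T (ra u ((Tt $ 1) v) + la ((Tt $ 1) u) v + (H (T u) ((Tt $ 1) v) + H ((Tt $ 1) u) (T v)))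
        + (Tt $ 1) (ra u (T v) + la (T u) v + H (T u) (T v))"
      by (simp add: fps_bilinear_nth_0 fps_bilinear_nth_1 app T T_0
          additive.zero[OF additive_maps(1)] additive.zero[OF additive_maps(4)])
    ultimately show ?thesis
      by (simp add: d_T1_def module_hom.add[OF hom[of 0], unfolded T] module_hom.add[OF hom[of 1], simplified]
          algebra_simps)
  qed
  with hom show ?thesis
    by (simp add: Z1_T_def)
qed

text \<open>At order t the intertwining condition reads \<open>(Tt $ 1) u + (a * T u - T u * a) = T
  ((\<psi> $ 1) u) + (Tt' $ 1) u\<close>. Solving for the difference of the linear terms and
  expanding \<open>\<psi> $ 1\<close> by linearity of \<open>T\<close> gives \<open>d_T0\<close> at
  \<open>a\<close>.\<close>

lemma equivalent_deformations_linear_terms: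
  assumes "formal_deformation sA sM la ra H T Tt"
    and "formal_deformation sA sM la ra H T Tt'"
    and "equivalent_deformations sA sM la ra H T Tt Tt'"
  shows "(\<lambda>u. (Tt $ 1) u - (Tt' $ 1) u) \<in> B1_T la ra H T"
proof -
  have hom: "module_hom sM sA (Tt $ i)" "module_hom sM sA (Tt' $ i)" for i
    using assms by (auto simp: formal_deformation_def)
  have T: "Tt $ 0 = T" "Tt' $ 0 = T"
    using assms by (auto simp: formal_deformation_def)
  note T_simps = module_hom.zero[OF hom(1)[of 0], unfolded T]
    module_hom.add[OF hom(1)[of 0], unfolded T]
    module_hom.diff[OF hom(1)[of 0], unfolded T]
  obtain a \<phi> \<psi> where
    \<phi>: "\<phi> $ 0 = id" "\<phi> $ Suc 0 = (\<lambda>b. a * b - b * a)" and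
    \<psi>: "\<psi> $ 0 = id" "\<psi> $ Suc 0 = (\<lambda>u. la a u - ra u a + H a (T u) - H (T u) a)" and
    eq: "\<And>u. fps_app \<phi> (fps_app Tt u) = fps_app Tt' (fps_app \<psi> u)"
    using assms(3) by (auto simp: equivalent_deformations_def trb_morphism_def)
  have "(Tt $ 1) u - (Tt' $ 1) u = d_T0 la ra H T a u" for u
  proof -
    have "fps_app \<phi> (fps_app Tt (fps_const u)) $ 1 = fps_app Tt' (fps_app \<psi> (fps_const u)) $ 1"
      by (simp add: eq)
    then show ?thesis
      by (simp add: fps_app_nth_0 fps_app_nth_1 T \<phi> \<psi> T_simps d_T0_def
          algebra_simps)
  qed
  then show ?thesis
    by (auto simp: B1_T_def fun_eq_iff image_iff)
qed

theorem theorem4p6: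
  fixes sA :: "'k::field_char_0 \<Rightarrow> 'a::ring \<Rightarrow> 'a"
    and sM :: "'k \<Rightarrow> 'm::ab_group_add \<Rightarrow> 'm"
    and la :: "'a \<Rightarrow> 'm \<Rightarrow> 'm"
    and ra :: "'m \<Rightarrow> 'a \<Rightarrow> 'm"
    and H :: "'a \<Rightarrow> 'a \<Rightarrow> 'm"
    and T :: "'m \<Rightarrow> 'a"
    and Tt :: "('m \<Rightarrow> 'a) fps"
  assumes "hochschild_2cocycle sA sM la ra H"
    and "twisted_rota_baxter sA sM la ra H T"
    and "formal_deformation sA sM la ra H T Tt"
  shows "Tt $ 1 \<in> Z1_T sA sM la ra H T \<and>
    class_T sA sM la ra H T (Tt $ 1) \<in> H1_T sA sM la ra H T \<and>
    (\<forall>Tt'. formal_deformation sA sM la ra H T Tt' \<longrightarrow>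
       equivalent_deformations sA sM la ra H T Tt Tt' \<longrightarrow>
       class_T sA sM la ra H T (Tt $ 1) = class_T sA sM la ra H T (Tt' $ 1))"
proof -
  interpret hochschild_2cocycle sA sM la ra H by fact
  have hom: "module_hom sM sA T"
    using assms(2) by (simp add: twisted_rota_baxter_def)
  note cocycle_1 = linear_term_cocycle[OF assms(1) assms(3)]
  have "class_T sA sM la ra H T (Tt $ 1) = class_T sA sM la ra H T (Tt' $ 1)"
    if "formal_deformation sA sM la ra H T Tt'" "equivalent_deformations sA sM la ra H T Tt Tt'" for Tt'
  proof -
    \<comment> \<open>The relation lives on cocycles, so the cocycle property is needed for both
      linear terms besides the coboundary.\<close>
    have "(Tt $ 1, Tt' $ 1) \<in> cohomologous_T sA sM la ra H T"
      using cocycle_1 linear_term_cocycle[OF assms(1) that(1)]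
        equivalent_deformations_linear_terms[OF assms(3) that]
      by (simp add: cohomologous_T_def)
    then show ?thesis
      unfolding class_T_def by (rule equiv_class_eq[OF equiv_cohomologous_T[OF hom]])
  qed
  with cocycle_1 show ?thesis
    by (simp add: class_T_def H1_T_def quotientI)
qed

end
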